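(* Let $(G,q_1)$ and $(\Gamma,q_2)$ be metric groups with $|G|$ even, $|\Gamma|$ odd, and $c:=\mathcal{G}(q_1)=-\mathcal{G}(q_2)$. Let $S,T,C$ be the $J\times J$ matrices defined in the context. Then $S$, $T$ and $C$ are unitary matrices satisfying $S^2=C$, $(ST)^3=cC$ and $TC=CT$.
   Context: A metric group $(G,q)$ is a finite abelian group $G$ with a map $q:G\to\mathbb{T}=\{z\in\mathbb{C}:|z|=1\}$ such that $q(-g)=q(g)$ and $\langle g,h\rangle=q(g+h)q(g)^{-1}q(h)^{-1}$ is a non-degenerate bicharacter. $\mathcal{G}(q)=\frac{1}{\sqrt{|G|}}\sum_{g\in G}q(g)$. Let $K=G_2=\{g\in G:2g=0\}$, $a=1/\sqrt{|G|}$, $b=1/\sqrt{|\Gamma|}$. Fix $G_*\subset G$, $\Gamma_*\subset\Gamma$ with $G=K\sqcup G_*\sqcup(-G_* )$, $\Gamma=\{0\}\sqcup\Gamma_*\sqcup(-\Gamma_* )$. Let $J_1=(K\setminus\{0\})\times\{1,-1\}$ and $J=\{0,\pi\}\sqcup J_1\sqcup G_*\sqcup\Gamma_*$. Involution on $J$: $\overline{(k,\varepsilon)}=(k,c^2\langle k,k\rangle\varepsilon)$ for $(k,\varepsilon)\in J_1$ (here $c^2\in\{1,-1\}$ since $\Gamma$ is odd), all other elements fixed. With blocks indexed in order by $\{0\},\{\pi\},J_1,G_*,\Gamma_*$ (rows $0,\pi,(k,\varepsilon),g,\gamma$; columns with primes): $$S=\begin{pmatrix} \frac{a-b}{2}&\frac{a+b}{2}&\frac{a}{2}&a&b\\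 \frac{a+b}{2}&\frac{a-b}{2}&\frac{a}{2}&a&-b\\ \frac{a}{2}&\frac{a}{2}&\frac{a\langle k,k'\rangle+c\varepsilon\varepsilon'q_1(k)\delta_{k,k'}}{2}&a\langle k,g'\rangle&0\\ a&a&a\langle g,k'\rangle&a(\langle g,g'\rangle+\overline{\langle g,g'\rangle})&0\\ b&-b&0&0&-b(\langle\gamma,\gamma'\rangle+\overline{\langle\gamma,\gamma'\rangle}) \end{pmatrix},$$ $T=\mathrm{Diag}(1,1,q_1(k),q_1(g),q_2(\gamma))$, and $C_{x,y}=\delta_{x,\overline y}$. *)

theory Defs
  imports Complex_Main "HOL-Library.Cardinality"
begin

text \<open>
  A finite abelian group is a type of class \<open>{finite, ab_group_add}\<close>, and the circle group
  is the set of complex numbers of norm 1.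
\<close>

definition bichar :: "('g::ab_group_add \<Rightarrow> complex) \<Rightarrow> 'g \<Rightarrow> 'g \<Rightarrow> complex" where
  "bichar q g h = q (g + h) * inverse (q g) * inverse (q h)"

definition is_bicharacter :: "('g::ab_group_add \<Rightarrow> 'g \<Rightarrow> complex) \<Rightarrow> bool" where
  "is_bicharacter B \<longleftrightarrow>
     (\<forall>g h. norm (B g h) = 1) \<and>
     (\<forall>g g' h. B (g + g') h = B g h * B g' h) \<and>
     (\<forall>g h h'. B g (h + h') = B g h * B g h')"

definition nondegenerate :: "('g::ab_group_add \<Rightarrow> 'g \<Rightarrow> complex) \<Rightarrow> bool" where
  "nondegenerate B \<longleftrightarrow>
     (\<forall>g. (\<forall>h. B g h = 1) \<longrightarrow> g = 0) \<and> (\<forall>h. (\<forall>g. B g h = 1) \<longrightarrow> h = 0)"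

definition metric_group :: "('g::{finite,ab_group_add} \<Rightarrow> complex) \<Rightarrow> bool" where
  "metric_group q \<longleftrightarrow>
     (\<forall>g. norm (q g) = 1) \<and> (\<forall>g. q (- g) = q g) \<and>
     is_bicharacter (bichar q) \<and> nondegenerate (bichar q)"

definition inv_sqrt_order :: "'g::finite itself \<Rightarrow> complex" where
  "inv_sqrt_order _ = complex_of_real (1 / sqrt (real CARD('g)))"

definition gauss_sum :: "('g::{finite,ab_group_add} \<Rightarrow> complex) \<Rightarrow> complex" where
  "gauss_sum q = inv_sqrt_order TYPE('g) * (\<Sum>g\<in>UNIV. q g)"

definition two_torsion :: "'g::ab_group_add set" where
  "two_torsion = {g. g + g = 0}"

text \<open>The whole group is the disjoint union of \<open>B\<close>, \<open>A\<close> and \<open>-A\<close>.\<close>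

definition splits_over :: "'g::ab_group_add set \<Rightarrow> 'g set \<Rightarrow> bool" where
  "splits_over B A \<longleftrightarrow>
     UNIV = B \<union> A \<union> uminus ` A \<and>
     B \<inter> A = {} \<and> B \<inter> uminus ` A = {} \<and> A \<inter> uminus ` A = {}"

text \<open>
  The labels of rows and columns. The signs \<open>\<epsilon>\<close> are kept as complex numbers, as they are
  multiplied with complex numbers both in the matrix entries and in the involution;
  \<open>index_set\<close> restricts them to 1 and -1.
\<close>

datatype ('g, 'h) label =
    L0 | Lpi | LK 'g complex | LG 'g | LGam 'h

definition index_set :: "'g::ab_group_add set \<Rightarrow> 'h set \<Rightarrow> ('g, 'h) label set" where
  "index_set Gs \<Gamma>s =
     {L0, Lpi} \<union> {LK k \<epsilon> |k \<epsilon>. k \<in> two_torsion - {0} \<and> \<epsilon> \<in> {1, -1}} \<union> LG ` Gs \<union> LGam ` \<Gamma>s"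

fun label_bar :: "('g::ab_group_add \<Rightarrow> complex) \<Rightarrow> complex \<Rightarrow> ('g, 'h) label \<Rightarrow> ('g, 'h) label" where
  "label_bar q1 c (LK k \<epsilon>) = LK k (c\<^sup>2 * bichar q1 k k * \<epsilon>)"
| "label_bar q1 c x = x"

fun S_block :: "complex \<Rightarrow> complex \<Rightarrow> ('g::ab_group_add \<Rightarrow> complex) \<Rightarrow> ('h::ab_group_add \<Rightarrow> complex)
    \<Rightarrow> complex \<Rightarrow> ('g, 'h) label \<Rightarrow> ('g, 'h) label \<Rightarrow> complex" where
  "S_block a b q1 q2 c L0 L0 = (a - b) / 2"
| "S_block a b q1 q2 c L0 Lpi = (a + b) / 2"
| "S_block a b q1 q2 c L0 (LK k' \<epsilon>') = a / 2"
| "S_block a b q1 q2 c L0 (LG g') = a"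
| "S_block a b q1 q2 c L0 (LGam \<gamma>') = b"

| "S_block a b q1 q2 c Lpi L0 = (a + b) / 2"
| "S_block a b q1 q2 c Lpi Lpi = (a - b) / 2"
| "S_block a b q1 q2 c Lpi (LK k' \<epsilon>') = a / 2"
| "S_block a b q1 q2 c Lpi (LG g') = a"
| "S_block a b q1 q2 c Lpi (LGam \<gamma>') = - b"

| "S_block a b q1 q2 c (LK k \<epsilon>) L0 = a / 2"
| "S_block a b q1 q2 c (LK k \<epsilon>) Lpi = a / 2"
| "S_block a b q1 q2 c (LK k \<epsilon>) (LK k' \<epsilon>') =
     (a * bichar q1 k k' + c * \<epsilon> * \<epsilon>' * q1 k * (if k = k' then 1 else 0)) / 2"
| "S_block a b q1 q2 c (LK k \<epsilon>) (LG g') = a * bichar q1 k g'"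
| "S_block a b q1 q2 c (LK k \<epsilon>) (LGam \<gamma>') = 0"

| "S_block a b q1 q2 c (LG g) L0 = a"
| "S_block a b q1 q2 c (LG g) Lpi = a"
| "S_block a b q1 q2 c (LG g) (LK k' \<epsilon>') = a * bichar q1 g k'"
| "S_block a b q1 q2 c (LG g) (LG g') = a * (bichar q1 g g' + cnj (bichar q1 g g'))"
| "S_block a b q1 q2 c (LG g) (LGam \<gamma>') = 0"

| "S_block a b q1 q2 c (LGam \<gamma>) L0 = b"
| "S_block a b q1 q2 c (LGam \<gamma>) Lpi = - b"
| "S_block a b q1 q2 c (LGam \<gamma>) (LK k' \<epsilon>') = 0"
| "S_block a b q1 q2 c (LGam \<gamma>) (LG g') = 0"
| "S_block a b q1 q2 c (LGam \<gamma>) (LGam \<gamma>') =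
     - b * (bichar q2 \<gamma> \<gamma>' + cnj (bichar q2 \<gamma> \<gamma>'))"

definition S_mat :: "('g::{finite,ab_group_add} \<Rightarrow> complex) \<Rightarrow> ('h::{finite,ab_group_add} \<Rightarrow> complex)
    \<Rightarrow> complex \<Rightarrow> ('g, 'h) label \<Rightarrow> ('g, 'h) label \<Rightarrow> complex" where
  "S_mat q1 q2 c = S_block (inv_sqrt_order TYPE('g)) (inv_sqrt_order TYPE('h)) q1 q2 c"

fun T_diag :: "('g \<Rightarrow> complex) \<Rightarrow> ('h \<Rightarrow> complex) \<Rightarrow> ('g, 'h) label \<Rightarrow> complex" where
  "T_diag q1 q2 L0 = 1"
| "T_diag q1 q2 Lpi = 1"
| "T_diag q1 q2 (LK k \<epsilon>) = q1 k"
| "T_diag q1 q2 (LG g) = q1 g"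
| "T_diag q1 q2 (LGam \<gamma>) = q2 \<gamma>"

definition T_mat :: "('g \<Rightarrow> complex) \<Rightarrow> ('h \<Rightarrow> complex)
    \<Rightarrow> ('g, 'h) label \<Rightarrow> ('g, 'h) label \<Rightarrow> complex" where
  "T_mat q1 q2 x y = (if x = y then T_diag q1 q2 x else 0)"

definition C_mat :: "('g::ab_group_add \<Rightarrow> complex) \<Rightarrow> complex
    \<Rightarrow> ('g, 'h) label \<Rightarrow> ('g, 'h) label \<Rightarrow> complex" where
  "C_mat q1 c x y = (if x = label_bar q1 c y then 1 else 0)"

text \<open>
  The index set depends on the chosen subsets and hence is not a type. A \<open>J \<times> J\<close> matrix is a
  function of two labels, only whose values on \<open>J \<times> J\<close> matter: products sum over \<open>J\<close>, and
  equality is equality of the entries in \<open>J \<times> J\<close>.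
\<close>

definition mat_eq :: "'i set \<Rightarrow> ('i \<Rightarrow> 'i \<Rightarrow> complex) \<Rightarrow> ('i \<Rightarrow> 'i \<Rightarrow> complex) \<Rightarrow> bool" where
  "mat_eq J A B \<longleftrightarrow> (\<forall>x\<in>J. \<forall>y\<in>J. A x y = B x y)"

definition mat_mult :: "'i set \<Rightarrow> ('i \<Rightarrow> 'i \<Rightarrow> complex) \<Rightarrow> ('i \<Rightarrow> 'i \<Rightarrow> complex)
    \<Rightarrow> 'i \<Rightarrow> 'i \<Rightarrow> complex" where
  "mat_mult J A B x y = (\<Sum>z\<in>J. A x z * B z y)"

definition mat_one :: "'i \<Rightarrow> 'i \<Rightarrow> complex" where
  "mat_one x y = (if x = y then 1 else 0)"

primrec mat_pow :: "'i set \<Rightarrow> ('i \<Rightarrow> 'i \<Rightarrow> complex) \<Rightarrow> nat \<Rightarrow> 'i \<Rightarrow> 'i \<Rightarrow> complex" where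
  "mat_pow J A 0 = mat_one"
| "mat_pow J A (Suc n) = mat_mult J A (mat_pow J A n)"

definition mat_scale :: "complex \<Rightarrow> ('i \<Rightarrow> 'i \<Rightarrow> complex) \<Rightarrow> 'i \<Rightarrow> 'i \<Rightarrow> complex" where
  "mat_scale s A x y = s * A x y"

definition mat_adjoint :: "('i \<Rightarrow> 'i \<Rightarrow> complex) \<Rightarrow> 'i \<Rightarrow> 'i \<Rightarrow> complex" where
  "mat_adjoint A x y = cnj (A y x)"

definition mat_unitary :: "'i set \<Rightarrow> ('i \<Rightarrow> 'i \<Rightarrow> complex) \<Rightarrow> bool" where
  "mat_unitary J A \<longleftrightarrow>
     mat_eq J (mat_mult J A (mat_adjoint A)) mat_one \<and>
     mat_eq J (mat_mult J (mat_adjoint A) A) mat_one"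

end

theory Submission
  imports Defs "Jordan_Normal_Form.Schur_Decomposition"
begin

text \<open>
  A row of \<open>S\<close> amounts to an even function on \<open>G\<close>, an even function on \<open>\<Gamma>\<close> and a function on
  \<open>K - {0}\<close>: the coordinates \<open>0 \<plusminus> \<pi>\<close> give the values at the neutral elements, and
  \<open>(k,1) \<plusminus> (k,-1)\<close> separate the first from the third function. In these coordinates \<open>S\<close> is
  the Fourier transform of \<open>G\<close>, minus the Fourier transform of \<open>\<Gamma>\<close>, and the diagonal matrix with
  entries \<open>c q\<^sub>1(k)\<close>. Orthogonality of characters gives \<open>S\<^sup>2 = C\<close> and unitarity; completing the square
  in a Gauss sum gives \<open>S T S = c T\<^sup>* S T\<^sup>*\<close>, where the two signs in \<open>c = \<G>(q\<^sub>1) = -\<G>(q\<^sub>2)\<close> make the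
  constants agree, and \<open>(S T)\<^sup>3 = c C\<close> follows. That the involution is well defined rests on
  \<open>c\<^sup>4 = 1\<close>: the square of the Gauss sum of an odd group is the square of the trace of its Fourier
  transform, which has order dividing 4, so that the trace is a Gaussian integer of norm 1.
\<close>

section \<open>Metric groups and Gauss sums\<close>

lemma metric_group_norm: "metric_group q \<Longrightarrow> norm (q g) = 1"
  by (simp add: metric_group_def)

lemma metric_group_nonzero: "metric_group q \<Longrightarrow> q g \<noteq> 0"
  using metric_group_norm[of q g] by auto

lemma metric_group_minus: "metric_group q \<Longrightarrow> q (- g) = q g"
  by (simp add: metric_group_def)

lemma metric_group_mult_cnj:
  assumes "metric_group q"
  shows "q g * cnj (q g) = 1" "cnj (q g) * q g = 1"
  using metric_group_norm[OF assms, of g] by (simp_all add: complex_norm_square[symmetric] mult.commute)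

lemma bichar_commute: "bichar q g h = bichar q h g"
  by (simp add: bichar_def ac_simps)

lemma bichar_norm: "metric_group q \<Longrightarrow> norm (bichar q g h) = 1"
  by (simp add: metric_group_def is_bicharacter_def)

lemma bichar_nonzero: "metric_group q \<Longrightarrow> bichar q g h \<noteq> 0"
  using bichar_norm[of q g h] by auto

lemma bichar_add_left: "metric_group q \<Longrightarrow> bichar q (g + g') h = bichar q g h * bichar q g' h"
  by (simp add: metric_group_def is_bicharacter_def)

lemma bichar_add_right: "metric_group q \<Longrightarrow> bichar q h (g + g') = bichar q h g * bichar q h g'"
  by (simp add: metric_group_def is_bicharacter_def)

lemma bichar_zero_left: "metric_group q \<Longrightarrow> bichar q 0 h = 1"
  using bichar_add_left[of q 0 0 h] bichar_nonzero[of q 0 h] by simp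

lemma bichar_zero_right: "metric_group q \<Longrightarrow> bichar q h 0 = 1"
  using bichar_zero_left[of q h] by (simp add: bichar_commute)

lemma bichar_minus_left:
  assumes "metric_group q"
  shows "bichar q (- g) h = cnj (bichar q g h)"
proof -
  have "bichar q g h * bichar q (- g) h = 1"
    using bichar_add_left[OF assms, of g "- g" h] bichar_zero_left[OF assms] by simp
  moreover have "bichar q g h * cnj (bichar q g h) = 1"
    using bichar_norm[OF assms, of g h] by (simp add: complex_norm_square[symmetric])
  ultimately show ?thesis
    using bichar_nonzero[OF assms, of g h] by (metis mult_left_cancel)
qed

lemma bichar_minus_right:
  "metric_group q \<Longrightarrow> bichar q h (- g) = cnj (bichar q h g)"
  by (metis bichar_commute bichar_minus_left)

lemma metric_group_zero:
  assumes "metric_group q"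
  shows "q 0 = 1"
  using bichar_zero_left[OF assms, of 0] metric_group_nonzero[OF assms, of 0]
  by (simp add: bichar_def field_simps)

lemma metric_group_add:
  assumes "metric_group q"
  shows "q (g + h) = q g * q h * bichar q g h"
  using metric_group_nonzero[OF assms, of g] metric_group_nonzero[OF assms, of h]
  by (simp add: bichar_def field_simps)

text \<open>Expanding \<open>q (g + (- g)) = q 0 = 1\<close> gives
  \<open>1 = q g * q g * cnj (bichar q g g)\<close>, and bicharacter values lie on the unit
  circle.\<close>

lemma bichar_self:
  assumes "metric_group q"
  shows "bichar q g g = (q g)\<^sup>2"
proof -
  have "1 = q g * q g * cnj (bichar q g g)"
    using metric_group_add[OF assms, of g "- g"] metric_group_zero[OF assms]
    by (simp add: metric_group_minus[OF assms] bichar_minus_right[OF assms])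
  moreover have "cnj (bichar q g g) * bichar q g g = 1"
    using bichar_norm[OF assms, of g g] by (simp add: complex_norm_square[symmetric] mult.commute)
  ultimately show ?thesis
    by (metis mult.assoc mult.left_neutral mult.right_neutral power2_eq_square)
qed

lemma bichar_two_torsion_cnj:
  assumes "metric_group q" "k \<in> two_torsion"
  shows "cnj (bichar q k g) = bichar q k g"
proof -
  have "- k = k" using assms(2) by (simp add: two_torsion_def minus_unique)
  then show ?thesis using bichar_minus_left[OF assms(1), of k g] by simp
qed

text \<open>Here \<open>1 = q (k + k) = (q k)\<^sup>2 * bichar q k k\<close>, and the last factor is
  again \<open>(q k)\<^sup>2\<close>. So \<open>bichar q k k\<close> is a sign, as the involution on
  labels requires.\<close>

lemma metric_group_two_torsion:
  assumes "metric_group q" "k \<in> two_torsion"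
  shows "q k * q k * (q k * q k) = 1"
proof -
  have "k + k = 0" using assms(2) by (simp add: two_torsion_def)
  then show ?thesis
    using metric_group_add[OF assms(1), of k k] bichar_self[OF assms(1), of k]
      metric_group_zero[OF assms(1)] by (simp add: power2_eq_square)
qed

section \<open>Character sums and Gauss sums\<close>

lemma sum_shift:
  fixes f :: "'a::{finite,ab_group_add} \<Rightarrow> 'b::comm_monoid_add"
  shows "(\<Sum>h\<in>UNIV. f (g + h)) = (\<Sum>h\<in>UNIV. f h)"
  by (rule sum.reindex_bij_witness[of _ "\<lambda>h. h - g" "\<lambda>h. g + h"]) auto

lemma sum_bichar:
  fixes q :: "'a::{finite,ab_group_add} \<Rightarrow> complex"
  assumes "metric_group q"
  shows "(\<Sum>h\<in>UNIV. bichar q g h) = (if g = 0 then of_nat CARD('a) else 0)"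
proof (cases "g = 0")
  case True
  then show ?thesis by (simp add: bichar_zero_left[OF assms])
next
  case False
  then obtain k where k: "bichar q g k \<noteq> 1"
    using assms unfolding metric_group_def nondegenerate_def by blast
  \<comment> \<open>Translation by an element \<open>k\<close> on which the character is nontrivial
    multiplies the sum by a factor other than 1 without changing it.\<close>
  have "(\<Sum>h\<in>UNIV. bichar q g h) = (\<Sum>h\<in>UNIV. bichar q g (k + h))"
    by (simp add: sum_shift)
  also have "\<dots> = bichar q g k * (\<Sum>h\<in>UNIV. bichar q g h)"
    by (simp add: bichar_add_right[OF assms] sum_distrib_left)
  finally have "(1 - bichar q g k) * (\<Sum>h\<in>UNIV. bichar q g h) = 0"
    by (simp add: algebra_simps)
  then show ?thesis using k False by simp
qed

text \<open>Completing the square: \<open>bichar q g h * q h\<close> is \<open>q (g + h)\<close>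
  divided by \<open>q g\<close>, and translation by \<open>g\<close> preserves the full sum.\<close>

lemma sum_bichar_quadratic:
  fixes q :: "'a::{finite,ab_group_add} \<Rightarrow> complex"
  assumes "metric_group q"
  shows "(\<Sum>h\<in>UNIV. bichar q g h * q h) = cnj (q g) * (\<Sum>h\<in>UNIV. q h)"
proof -
  have "(\<Sum>h\<in>UNIV. q h) = (\<Sum>h\<in>UNIV. q (g + h))"
    by (simp add: sum_shift)
  also have "\<dots> = q g * (\<Sum>h\<in>UNIV. bichar q g h * q h)"
    by (simp add: metric_group_add[OF assms] sum_distrib_left ac_simps bichar_commute[of q _ g])
  finally show ?thesis
    using metric_group_mult_cnj[OF assms, of g] by (simp add: mult.assoc[symmetric])
qed

lemma inv_sqrt_order_square:
  "inv_sqrt_order TYPE('a::finite) * inv_sqrt_order TYPE('a) * of_nat CARD('a) = 1"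
proof -
  let ?r = "sqrt (real CARD('a))"
  have "(1 / ?r) * (1 / ?r) * real CARD('a) = 1" by simp
  then have "complex_of_real ((1 / ?r) * (1 / ?r) * real CARD('a)) = 1"
    by (simp only: of_real_1)
  then show ?thesis
    by (simp only: inv_sqrt_order_def of_real_mult of_real_of_nat_eq)
qed

lemma cnj_inv_sqrt_order: "cnj (inv_sqrt_order TYPE('a::finite)) = inv_sqrt_order TYPE('a)"
  by (simp add: inv_sqrt_order_def)

text \<open>Replacing \<open>g\<close> by \<open>h + g\<close> in the double sum leaves a character
  sum over \<open>h\<close>, which by orthogonality survives only at \<open>g = 0\<close>.\<close>

lemma gauss_sum_mult_cnj:
  fixes q :: "'a::{finite,ab_group_add} \<Rightarrow> complex"
  assumes "metric_group q"
  shows "gauss_sum q * cnj (gauss_sum q) = 1"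
proof -
  have "(\<Sum>g\<in>UNIV. q g) * cnj (\<Sum>h\<in>UNIV. q h) = (\<Sum>h\<in>UNIV. \<Sum>g\<in>UNIV. q g * cnj (q h))"
    unfolding cnj_sum sum_product by (rule sum.swap)
  also have "\<dots> = (\<Sum>h\<in>UNIV. \<Sum>g\<in>UNIV. q (h + g) * cnj (q h))"
    by (intro sum.cong refl sum_shift[symmetric])
  also have "\<dots> = (\<Sum>h\<in>UNIV. \<Sum>g\<in>UNIV. q g * bichar q g h)"
  proof (intro sum.cong refl)
    fix h g
    have "q (h + g) * cnj (q h) = (q h * cnj (q h)) * (q g * bichar q g h)"
      by (simp only: metric_group_add[OF assms] bichar_commute[of q g h] ac_simps)
    then show "q (h + g) * cnj (q h) = q g * bichar q g h"
      by (simp add: metric_group_mult_cnj[OF assms])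
  qed
  also have "\<dots> = (\<Sum>g\<in>UNIV. q g * (\<Sum>h\<in>UNIV. bichar q g h))"
    by (subst sum.swap) (simp add: sum_distrib_left)
  also have "\<dots> = of_nat CARD('a)"
    by (simp add: sum_bichar[OF assms] metric_group_zero[OF assms] if_distrib cong: if_cong)
  finally show ?thesis
    using inv_sqrt_order_square[where 'a='a]
    by (simp add: gauss_sum_def cnj_inv_sqrt_order ac_simps)
qed

section \<open>Gauss sums of odd groups\<close>

lemma sum_list_diag:
  assumes "upper_triangular B" "B \<in> carrier_mat n n"
  shows "sum_list (diag_mat B) = (\<Sum>i<n. B $$ (i,i))"
  using assms by (simp add: diag_mat_def interv_sum_list_conv_sum_set_nat atLeast0LessThan)

lemma trace_mat_comm:
  fixes A B :: "'a::comm_ring_1 mat"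
  assumes "A \<in> carrier_mat n n" "B \<in> carrier_mat n n"
  shows "(\<Sum>i<n. (A * B) $$ (i,i)) = (\<Sum>i<n. (B * A) $$ (i,i))"
proof -
  have "(\<Sum>i<n. (A * B) $$ (i,i)) = (\<Sum>i<n. \<Sum>j<n. A $$ (i,j) * B $$ (j,i))"
    using assms by (simp add: scalar_prod_def atLeast0LessThan)
  also have "\<dots> = (\<Sum>j<n. \<Sum>i<n. B $$ (j,i) * A $$ (i,j))"
    by (subst sum.swap) (simp add: mult.commute)
  also have "\<dots> = (\<Sum>i<n. (B * A) $$ (i,i))"
    using assms by (simp add: scalar_prod_def atLeast0LessThan)
  finally show ?thesis .
qed

lemma complex_fourth_root_of_unity:
  fixes e :: complex
  assumes "e ^ 4 = 1"
  shows "e \<in> {1, -1, \<i>, -\<i>}"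
proof -
  have "(e - 1) * (e + 1) * ((e - \<i>) * (e + \<i>)) = 0"
    using assms by (simp add: algebra_simps power4_eq_xxxx)
  then show ?thesis by (auto simp: eq_neg_iff_add_eq_0)
qed

text \<open>By Schur triangularisation the trace is the sum of the eigenvalues, each of which is a
  fourth root of unity.\<close>

lemma trace_gaussian_int:
  fixes A :: "complex mat"
  assumes A: "A \<in> carrier_mat n n" and A4: "A ^\<^sub>m 4 = 1\<^sub>m n"
  shows "Re (\<Sum>i<n. A $$ (i,i)) \<in> \<int>" "Im (\<Sum>i<n. A $$ (i,i)) \<in> \<int>"
proof -
  obtain es where es: "char_poly A = (\<Prod>a\<leftarrow>es. [:- a, 1:])"
    using char_poly_factorized[OF A] by blast
  obtain B P Q where "schur_decomposition A es = (B, P, Q)"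
    by (cases "schur_decomposition A es")
  from schur_decomposition[OF A es this]
  have w: "similar_mat_wit A B P Q" and ut: "upper_triangular B" and d: "diag_mat B = es" by auto
  from similar_mat_witD2[OF A w]
  have QP: "Q * P = 1\<^sub>m n" and APBQ: "A = P * B * Q"
    and B: "B \<in> carrier_mat n n" and P: "P \<in> carrier_mat n n" and Q: "Q \<in> carrier_mat n n" by auto
  have "(\<Sum>i<n. A $$ (i,i)) = (\<Sum>i<n. (Q * (P * B)) $$ (i,i))"
    using trace_mat_comm[of "P * B" n Q] B P Q by (simp add: APBQ)
  also have "Q * (P * B) = B"
    using assoc_mult_mat[OF Q P B] QP B by simp
  finally have tr: "(\<Sum>i<n. A $$ (i,i)) = sum_list es"
    using sum_list_diag[OF ut B] d by simp
  have "e ^ 4 = 1" if "e \<in> set es" for e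
  proof -
    have "poly (char_poly A) e = 0" using linear_poly_root[OF that] es by simp
    then obtain v where v: "eigenvector A v e"
      using eigenvalue_root_char_poly[OF A] unfolding eigenvalue_def by blast
    then have vc: "v \<in> carrier_vec n" and v0: "v \<noteq> 0\<^sub>v n"
      using A by (auto simp: eigenvector_def)
    have "e ^ 4 \<cdot>\<^sub>v v = v"
      using eigenvector_pow[OF A v, of 4] A4 vc by simp
    \<comment> \<open>The equation \<open>e ^ 4 \<cdot>\<^sub>v v = v\<close> is read off at a
      nonzero coordinate of the eigenvector.\<close>
    moreover obtain i where "i < n" "v $ i \<noteq> 0"
      using v0 vc by (metis carrier_vecD eq_vecI index_zero_vec)
    ultimately show ?thesis
      using vc by (metis carrier_vecD index_smult_vec(1) mult_cancel_right1)
  qed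
  then have "\<forall>e\<in>set es. e \<in> {1, -1, \<i>, -\<i>}"
    using complex_fourth_root_of_unity by blast
  then have "Re (sum_list es) \<in> \<int> \<and> Im (sum_list es) \<in> \<int>"
    by (induction es) (auto)
  then show "Re (\<Sum>i<n. A $$ (i,i)) \<in> \<int>" "Im (\<Sum>i<n. A $$ (i,i)) \<in> \<int>"
    by (simp_all add: tr)
qed

lemma gaussian_int_norm_one:
  assumes "Re z \<in> \<int>" "Im z \<in> \<int>" "norm z = 1"
  shows "z ^ 4 = 1"
proof -
  obtain m n where mn: "Re z = of_int m" "Im z = of_int n"
    using assms by (auto elim!: Ints_cases)
  have "(Re z)\<^sup>2 + (Im z)\<^sup>2 = 1"
    using assms(3) by (simp add: cmod_power2[symmetric])
  then have "real_of_int (m\<^sup>2 + n\<^sup>2) = 1" by (simp add: mn)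
  then have 1: "m\<^sup>2 + n\<^sup>2 = 1" by linarith
  have "m = 0 \<or> n = 0"
  proof (rule ccontr)
    assume "\<not> ?thesis"
    then have "m\<^sup>2 > 0" "n\<^sup>2 > 0" by auto
    then show False using 1 by linarith
  qed
  with 1 have "(m = 0 \<and> (n = 1 \<or> n = -1)) \<or> (n = 0 \<and> (m = 1 \<or> m = -1))"
    by (auto simp: power2_eq_1_iff)
  then have "z \<in> {1, -1, \<i>, -\<i>}"
    using mn by (auto simp: complex_eq_iff)
  then show ?thesis by auto
qed

section \<open>Squares and fourth powers of Gauss sums of odd groups\<close>

lemma odd_group_double_zero:
  fixes x :: "'a::{finite,ab_group_add}"
  assumes "odd CARD('a)" "x + x = 0"
  shows "x = 0"
proof -
  have const: "(\<Sum>y\<in>A. x) = (if even (card A) then 0 else x)" if "finite A" for A :: "'a set"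
    using that by (induction A rule: finite_induct) (auto simp: assms(2))
  \<comment> \<open>Translation permutes the group, so \<open>CARD('a)\<close> copies of
    \<open>x\<close> add up to 0; since \<open>x + x = 0\<close>, an odd number of copies adds up to
    \<open>x\<close>.\<close>
  have "(\<Sum>y\<in>UNIV. x + y) = (\<Sum>y\<in>UNIV. y)"
    by (rule sum_shift)
  then have "(\<Sum>y\<in>(UNIV :: 'a set). x) = 0"
    by (simp only: sum.distrib) simp
  then show ?thesis
    using const[of UNIV] assms(1) by simp
qed

text \<open>In odd order \<open>(x, y) \<mapsto> (x + y, x - y)\<close> is a bijection. In
  \<open>q (x + y) * q (x - y)\<close> the mixed terms cancel, which separates the variables into
  \<open>(q x)\<^sup>2 * (q y)\<^sup>2\<close>.\<close>

lemma gauss_sum_odd_square: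
  fixes q :: "'a::{finite,ab_group_add} \<Rightarrow> complex"
  assumes "metric_group q" "odd CARD('a)"
  shows "(gauss_sum q)\<^sup>2 = (inv_sqrt_order TYPE('a) * (\<Sum>x\<in>UNIV. bichar q x x))\<^sup>2"
proof -
  have "inj (\<lambda>(x, y). (x + y, x - y :: 'a))"
  proof (rule injI, clarify)
    fix x y x' y' :: 'a
    assume eq: "x + y = x' + y'" "x - y = x' - y'"
    have "(x - x') + (x - x') = (x + y) - (x' + y') + ((x - y) - (x' - y'))"
      by (simp add: algebra_simps)
    then have "(x - x') + (x - x') = 0" by (simp add: eq)
    then have "x - x' = 0" by (rule odd_group_double_zero[OF assms(2)])
    then show "x = x' \<and> y = y'" using eq by auto
  qed
  then have bij: "bij (\<lambda>(x, y). (x + y, x - y :: 'a))"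
    by (simp add: finite_UNIV_inj_surj bij_def finite_prod)
  have "(\<Sum>x\<in>UNIV. q x) * (\<Sum>y\<in>UNIV. q y) = (\<Sum>(x, y)\<in>UNIV. q x * q y)"
    by (simp add: sum_product sum.cartesian_product)
  also have "\<dots> = (\<Sum>(x, y)\<in>UNIV. q (x + y) * q (x - y))"
    using sum.reindex_bij_betw[OF bij, of "\<lambda>(x, y). q x * q y", symmetric]
    by (simp add: case_prod_unfold)
  also have "\<dots> = (\<Sum>(x, y)\<in>UNIV. bichar q x x * bichar q y y)"
  proof (intro sum.cong refl, clarify)
    fix x y
    have "bichar q x y * cnj (bichar q x y) = 1"
      using bichar_norm[OF assms(1), of x y] by (simp add: complex_norm_square[symmetric])
    moreover have "q (x + y) * q (x - y)
        = (q x)\<^sup>2 * (q y)\<^sup>2 * (bichar q x y * cnj (bichar q x y))"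
      using metric_group_add[OF assms(1), of x y] metric_group_add[OF assms(1), of x "- y"]
      by (simp add: metric_group_minus[OF assms(1)] bichar_minus_right[OF assms(1)] power2_eq_square)
    ultimately show "q (x + y) * q (x - y) = bichar q x x * bichar q y y"
      by (simp add: bichar_self[OF assms(1)])
  qed
  also have "\<dots> = (\<Sum>x\<in>UNIV. bichar q x x) * (\<Sum>y\<in>UNIV. bichar q y y)"
    by (simp add: sum_product sum.cartesian_product)
  finally show ?thesis
    by (simp add: gauss_sum_def power2_eq_square ac_simps)
qed

text \<open>\<open>t\<close> is the trace of the Fourier transform, whose square is the permutation \<open>x \<mapsto> - x\<close>.\<close>

lemma fourier_trace:
  fixes q :: "'a::{finite,ab_group_add} \<Rightarrow> complex"
  assumes "metric_group q"
  defines "t \<equiv> inv_sqrt_order TYPE('a) * (\<Sum>x\<in>UNIV. bichar q x x)"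
  shows "Re t \<in> \<int>" "Im t \<in> \<int>"
proof -
  let ?n = "CARD('a)" and ?s = "inv_sqrt_order TYPE('a)"
  \<comment> \<open>An enumeration of the group turns operators on functions into matrices with
    numerical indices.\<close>
  obtain e :: "nat \<Rightarrow> 'a" where e: "bij_betw e {..<?n} UNIV"
    using ex_bij_betw_nat_finite[OF finite[of "UNIV :: 'a set"]] by (auto simp: atLeast0LessThan)
  define A where "A = mat ?n ?n (\<lambda>(i,j). ?s * bichar q (e i) (e j))"
  define P where "P = mat ?n ?n (\<lambda>(i,j). if e i + e j = 0 then 1 else 0 :: complex)"
  have A: "A \<in> carrier_mat ?n ?n" and P: "P \<in> carrier_mat ?n ?n" by (auto simp: A_def P_def)
  have AA: "A * A = P"
  proof (rule eq_matI)
    fix i j assume ij: "i < dim_row P" "j < dim_col P"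
    have "(A * A) $$ (i,j) = (\<Sum>k<?n. ?s * bichar q (e i) (e k) * (?s * bichar q (e k) (e j)))"
      using ij by (simp add: A_def P_def scalar_prod_def atLeast0LessThan)
    also have "\<dots> = (\<Sum>x\<in>UNIV. ?s * bichar q (e i) x * (?s * bichar q x (e j)))"
      by (rule sum.reindex_bij_betw[OF e])
    also have "\<dots> = ?s * ?s * (\<Sum>x\<in>UNIV. bichar q (e i + e j) x)"
      by (simp add: sum_distrib_left bichar_add_left[OF assms(1)] bichar_commute[of q _ "e j"] ac_simps)
    also have "\<dots> = P $$ (i,j)"
      using ij inv_sqrt_order_square[where 'a='a] by (simp add: P_def sum_bichar[OF assms(1)])
    finally show "(A * A) $$ (i,j) = P $$ (i,j)" .
  qed (auto simp: A_def P_def)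
  have PP: "P * P = 1\<^sub>m ?n"
  proof (rule eq_matI)
    fix i j assume "i < dim_row (1\<^sub>m ?n :: complex mat)" "j < dim_col (1\<^sub>m ?n :: complex mat)"
    then have ij: "i < ?n" "j < ?n" by auto
    have "(P * P) $$ (i,j) = (\<Sum>k<?n. (if e i + e k = 0 then 1 else 0) * (if e k + e j = 0 then 1 else 0))"
      using ij by (simp add: P_def scalar_prod_def atLeast0LessThan)
    also have "\<dots> = (\<Sum>x\<in>UNIV. (if e i + x = 0 then 1 else 0) * (if x + e j = 0 then 1 else 0))"
      by (rule sum.reindex_bij_betw[OF e])
    also have "\<dots> = (\<Sum>x\<in>UNIV. if x = - e i then (if - e i + e j = 0 then 1 else 0) else 0)"
      by (intro sum.cong refl) (auto simp: add_eq_0_iff)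
    also have "\<dots> = (if e i = e j then 1 else 0)"
      by simp
    also have "\<dots> = (1\<^sub>m ?n :: complex mat) $$ (i,j)"
      using ij bij_betw_imp_inj_on[OF e] by (auto simp: inj_on_def)
    finally show "(P * P) $$ (i,j) = (1\<^sub>m ?n :: complex mat) $$ (i,j)" .
  qed (auto simp: P_def)
  have "A ^\<^sub>m 4 = A * A * A * A"
    using A by (simp add: eval_nat_numeral)
  also have "\<dots> = 1\<^sub>m ?n"
    using assoc_mult_mat[OF P A A] PP by (simp add: AA)
  finally have A4: "A ^\<^sub>m 4 = 1\<^sub>m ?n" .
  have "(\<Sum>i<?n. A $$ (i,i)) = (\<Sum>i<?n. ?s * bichar q (e i) (e i))"
    by (simp add: A_def)
  also have "\<dots> = (\<Sum>x\<in>UNIV. ?s * bichar q x x)"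
    by (rule sum.reindex_bij_betw[OF e])
  finally have "t = (\<Sum>i<?n. A $$ (i,i))"
    by (simp add: t_def sum_distrib_left)
  then show "Re t \<in> \<int>" "Im t \<in> \<int>"
    using trace_gaussian_int[OF A A4] by simp_all
qed

text \<open>Only the squares of the Gauss sum and of the trace \<open>t\<close> are compared. This
  gives \<open>norm t = 1\<close>, so the Gaussian integer \<open>t\<close> is a unit and
  \<open>t ^ 4 = 1\<close>.\<close>

lemma gauss_sum_odd_fourth_power:
  fixes q :: "'a::{finite,ab_group_add} \<Rightarrow> complex"
  assumes "metric_group q" "odd CARD('a)"
  shows "gauss_sum q ^ 4 = 1"
proof -
  define t where "t = inv_sqrt_order TYPE('a) * (\<Sum>x\<in>UNIV. bichar q x x)"
  have sq: "(gauss_sum q)\<^sup>2 = t\<^sup>2"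
    using gauss_sum_odd_square[OF assms] by (simp add: t_def)
  have "(norm (gauss_sum q))\<^sup>2 = 1"
    using gauss_sum_mult_cnj[OF assms(1)] by (metis complex_norm_square of_real_eq_1_iff)
  then have "(norm t)\<^sup>2 = 1"
    using sq by (metis norm_power)
  then have "norm t = 1" by (simp add: power2_eq_1_iff) (smt (verit) norm_ge_zero)
  then have "t ^ 4 = 1"
    using gaussian_int_norm_one[of t] fourier_trace[OF assms(1)] by (simp add: t_def)
  then show ?thesis
    using sq by (metis (no_types) numeral_Bit0 power2_eq_square power_add)
qed

section \<open>Even characters\<close>

text \<open>The real part of a character, playing the role of a cosine; it is normalised to 1 at the
  neutral element.\<close>

definition even_char :: "('a::ab_group_add \<Rightarrow> complex) \<Rightarrow> 'a \<Rightarrow> 'a \<Rightarrow> complex" where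
  "even_char q x h = (bichar q x h + cnj (bichar q x h)) / 2"

lemma even_char_zero: "metric_group q \<Longrightarrow> even_char q x 0 = 1" "metric_group q \<Longrightarrow> even_char q 0 x = 1"
  by (simp_all add: even_char_def bichar_zero_right bichar_zero_left)

lemma even_char_minus: "metric_group q \<Longrightarrow> even_char q x (- h) = even_char q x h"
  by (simp add: even_char_def bichar_minus_right)

lemma cnj_even_char: "cnj (even_char q x h) = even_char q x h"
  by (simp add: even_char_def add.commute)

lemma even_char_two_torsion:
  assumes "metric_group q" "k \<in> two_torsion"
  shows "even_char q k g = bichar q k g" "even_char q g k = bichar q g k"
  using bichar_two_torsion_cnj[OF assms, of g]
  by (simp_all add: even_char_def bichar_commute[of q g k])

text \<open>The analogue of the product formula for cosines. It reduces sums of products to sums of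
  single even characters.\<close>

lemma even_char_mult:
  assumes "metric_group q"
  shows "even_char q x h * even_char q y h = (even_char q (x + y) h + even_char q (x - y) h) / 2"
  using bichar_add_left[OF assms, of x "- y" h]
  by (simp add: even_char_def bichar_add_left[OF assms] bichar_minus_left[OF assms] field_simps)

lemma sum_even_char:
  fixes q :: "'a::{finite,ab_group_add} \<Rightarrow> complex"
  assumes "metric_group q"
  shows "(\<Sum>h\<in>UNIV. even_char q x h) = (if x = 0 then of_nat CARD('a) else 0)"
proof -
  have "(\<Sum>h\<in>UNIV. even_char q x h)
      = ((\<Sum>h\<in>UNIV. bichar q x h) + (\<Sum>h\<in>UNIV. bichar q (- x) h)) / 2"
    by (simp add: even_char_def bichar_minus_left[OF assms] sum.distrib sum_divide_distrib[symmetric])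
  then show ?thesis by (simp add: sum_bichar[OF assms])
qed

lemma sum_even_char_quadratic:
  fixes q :: "'a::{finite,ab_group_add} \<Rightarrow> complex"
  assumes "metric_group q"
  shows "(\<Sum>h\<in>UNIV. even_char q x h * q h) = cnj (q x) * (\<Sum>h\<in>UNIV. q h)"
proof -
  have "even_char q x h * q h = (bichar q x h * q h + bichar q (- x) h * q h) / 2" for h
    by (simp add: even_char_def bichar_minus_left[OF assms] algebra_simps)
  then have "(\<Sum>h\<in>UNIV. even_char q x h * q h)
      = ((\<Sum>h\<in>UNIV. bichar q x h * q h) + (\<Sum>h\<in>UNIV. bichar q (- x) h * q h)) / 2"
    by (simp only: sum.distrib sum_divide_distrib[symmetric])
  then show ?thesis by (simp add: sum_bichar_quadratic[OF assms] metric_group_minus[OF assms])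
qed

text \<open>Two indicators occur because \<open>x\<close> and \<open>- x\<close> have the same even
  character; for \<open>x = y\<close> of order at most 2 both equal 1.\<close>

lemma sum_even_char_mult:
  fixes q :: "'a::{finite,ab_group_add} \<Rightarrow> complex"
  assumes "metric_group q"
  shows "(\<Sum>h\<in>UNIV. even_char q x h * even_char q y h)
    = of_nat CARD('a) * ((if x = y then 1 else 0) + (if x + y = 0 then 1 else 0)) / 2"
proof -
  have "(\<Sum>h\<in>UNIV. even_char q x h * even_char q y h)
      = ((\<Sum>h\<in>UNIV. even_char q (x + y) h) + (\<Sum>h\<in>UNIV. even_char q (x - y) h)) / 2"
    by (simp add: even_char_mult[OF assms] sum.distrib sum_divide_distrib[symmetric])
  then show ?thesis by (simp add: sum_even_char[OF assms])
qed

text \<open>After the product formula, completing the square yields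
  \<open>cnj (q (x + y)) + cnj (q (x - y))\<close>, whose common factor leaves twice the even
  character at \<open>x\<close>, \<open>y\<close>.\<close>

lemma sum_even_char_mult_quadratic:
  fixes q :: "'a::{finite,ab_group_add} \<Rightarrow> complex"
  assumes "metric_group q"
  shows "(\<Sum>h\<in>UNIV. even_char q x h * even_char q y h * q h)
    = cnj (q x) * cnj (q y) * even_char q x y * (\<Sum>h\<in>UNIV. q h)"
proof -
  have "even_char q x h * even_char q y h * q h
      = (even_char q (x + y) h * q h + even_char q (x - y) h * q h) / 2" for h
    by (simp add: even_char_mult[OF assms] algebra_simps)
  then have "(\<Sum>h\<in>UNIV. even_char q x h * even_char q y h * q h)
      = ((\<Sum>h\<in>UNIV. even_char q (x + y) h * q h) + (\<Sum>h\<in>UNIV. even_char q (x - y) h * q h)) / 2"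
    by (simp only: sum.distrib sum_divide_distrib[symmetric])
  also have "\<dots> = (cnj (q (x + y)) + cnj (q (x - y))) / 2 * (\<Sum>h\<in>UNIV. q h)"
    by (simp add: sum_even_char_quadratic[OF assms] distrib_right)
  also have "cnj (q (x + y)) + cnj (q (x - y)) = cnj (q x) * cnj (q y) * (2 * even_char q x y)"
  proof -
    have "q (x - y) = q x * q y * cnj (bichar q x y)"
      using metric_group_add[OF assms, of x "- y"]
      by (simp add: metric_group_minus[OF assms] bichar_minus_right[OF assms])
    then show ?thesis
      unfolding metric_group_add[OF assms, of x y] even_char_def by (simp add: field_simps)
  qed
  finally show ?thesis by simp
qed

section \<open>Rows of the S-matrix as even functions\<close>

lemma sum_even_splits:
  fixes f :: "'a::{finite,ab_group_add} \<Rightarrow> complex"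
  assumes "splits_over B A" "\<And>g. f (- g) = f g"
  shows "(\<Sum>g\<in>UNIV. f g) = (\<Sum>g\<in>B. f g) + 2 * (\<Sum>g\<in>A. f g)"
proof -
  have U: "(UNIV :: 'a set) = B \<union> A \<union> uminus ` A" and d: "(B \<union> A) \<inter> uminus ` A = {}" "B \<inter> A = {}"
    using assms(1) unfolding splits_over_def by blast+
  have "(\<Sum>g\<in>UNIV. f g) = (\<Sum>g\<in>B. f g) + (\<Sum>g\<in>A. f g) + (\<Sum>g\<in>uminus ` A. f g)"
    unfolding U using d by (simp add: sum.union_disjoint)
  also have "(\<Sum>g\<in>uminus ` A. f g) = (\<Sum>g\<in>A. f g)"
    by (simp add: sum.reindex inj_on_def assms(2))
  finally show ?thesis by simp
qed

lemma index_set_finite [simp]: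
  "finite (index_set (Gs :: 'g::{finite,ab_group_add} set) (\<Gamma>s :: 'h::finite set))"
proof -
  have "{LK k \<epsilon> |k \<epsilon>. k \<in> two_torsion - {0} \<and> \<epsilon> \<in> {1, -1}}
      = (\<lambda>(k, \<epsilon>). LK k \<epsilon> :: ('g, 'h) label) ` ((two_torsion - {0}) \<times> {1, -1})"
    by auto
  then show ?thesis by (simp add: index_set_def)
qed

lemma sum_index_set:
  fixes f :: "('g::{finite,ab_group_add}, 'h::finite) label \<Rightarrow> complex"
  shows "(\<Sum>z\<in>index_set Gs \<Gamma>s. f z) = f L0 + f Lpi
    + (\<Sum>k\<in>two_torsion - {0}. f (LK k 1) + f (LK k (-1))) + (\<Sum>g\<in>Gs. f (LG g)) + (\<Sum>h\<in>\<Gamma>s. f (LGam h))"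
proof -
  let ?P = "(two_torsion - {0 :: 'g}) \<times> {1, -1 :: complex}"
  let ?K = "(\<lambda>(k, \<epsilon>). LK k \<epsilon> :: ('g, 'h) label) ` ?P"
  have J: "index_set Gs \<Gamma>s = {L0, Lpi} \<union> ?K \<union> LG ` Gs \<union> LGam ` \<Gamma>s"
    by (auto simp: index_set_def)
  have "(\<Sum>z\<in>index_set Gs \<Gamma>s. f z)
      = (\<Sum>z\<in>{L0, Lpi}. f z) + (\<Sum>z\<in>?K. f z) + (\<Sum>z\<in>LG ` Gs. f z) + (\<Sum>z\<in>LGam ` \<Gamma>s. f z)"
    unfolding J by (subst sum.union_disjoint; (simp; fail)?; (auto; fail)?)+
  also have "(\<Sum>z\<in>?K. f z) = (\<Sum>(k, \<epsilon>)\<in>?P. f (LK k \<epsilon>))"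
    by (subst sum.reindex) (auto simp: inj_on_def case_prod_unfold)
  also have "\<dots> = (\<Sum>k\<in>two_torsion - {0}. f (LK k 1) + f (LK k (-1)))"
    by (simp add: sum.cartesian_product[symmetric])
  also have "(\<Sum>z\<in>LG ` Gs. f z) = (\<Sum>g\<in>Gs. f (LG g))"
    by (simp add: sum.reindex inj_on_def)
  also have "(\<Sum>z\<in>LGam ` \<Gamma>s. f z) = (\<Sum>h\<in>\<Gamma>s. f (LGam h))"
    by (simp add: sum.reindex inj_on_def)
  finally show ?thesis by simp
qed

text \<open>The inverse of the coordinate change: \<open>A 0\<close> is the sum of the entries at
  \<open>0\<close> and \<open>\<pi>\<close>, \<open>B 0\<close> the entry at \<open>\<pi>\<close>
  minus the one at \<open>0\<close>; \<open>A k\<close> and \<open>E k\<close> are the sum and the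
  difference of the entries at \<open>(k,1)\<close> and \<open>(k,-1)\<close>.\<close>

fun even_row :: "('g::ab_group_add \<Rightarrow> complex) \<Rightarrow> ('h::ab_group_add \<Rightarrow> complex) \<Rightarrow> ('g \<Rightarrow> complex)
    \<Rightarrow> ('g, 'h) label \<Rightarrow> complex" where
  "even_row A B E L0 = (A 0 - B 0) / 2"
| "even_row A B E Lpi = (A 0 + B 0) / 2"
| "even_row A B E (LK k \<epsilon>) = (A k + \<epsilon> * E k) / 2"
| "even_row A B E (LG g) = A g"
| "even_row A B E (LGam h) = B h"

text \<open>In the coordinates \<open>(A, B, E)\<close> the standard bilinear form of the index set is half the sum
  of the standard forms of the two groups and of the nonzero 2-torsion elements.\<close>

lemma sum_even_row_mult:
  fixes A A' t :: "'g::{finite,ab_group_add} \<Rightarrow> complex"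
    and B B' u :: "'h::{finite,ab_group_add} \<Rightarrow> complex"
  assumes "splits_over two_torsion Gs" "splits_over {0} \<Gamma>s"
    and "\<And>g. A (- g) = A g" "\<And>g. A' (- g) = A' g" "\<And>g. t (- g) = t g" "t 0 = 1"
    and "\<And>h. B (- h) = B h" "\<And>h. B' (- h) = B' h" "\<And>h. u (- h) = u h" "u 0 = 1"
  shows "(\<Sum>z\<in>index_set Gs \<Gamma>s. even_row A B E z * even_row A' B' E' z * T_diag t u z)
    = ((\<Sum>g\<in>UNIV. A g * A' g * t g) + (\<Sum>h\<in>UNIV. B h * B' h * u h)
      + (\<Sum>k\<in>two_torsion - {0}. E k * E' k * t k)) / 2"
proof -
  let ?K = "two_torsion - {0 :: 'g}"
  have tt: "(\<Sum>k\<in>two_torsion. f k) = f 0 + (\<Sum>k\<in>?K. f k)" for f :: "'g \<Rightarrow> complex"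
    by (rule sum.remove) (auto simp: two_torsion_def)
  have G: "(\<Sum>g\<in>UNIV. A g * A' g * t g)
      = A 0 * A' 0 + (\<Sum>k\<in>?K. A k * A' k * t k) + 2 * (\<Sum>g\<in>Gs. A g * A' g * t g)"
    using sum_even_splits[OF assms(1), of "\<lambda>g. A g * A' g * t g"] assms by (simp add: tt)
  have H: "(\<Sum>h\<in>UNIV. B h * B' h * u h) = B 0 * B' 0 + 2 * (\<Sum>h\<in>\<Gamma>s. B h * B' h * u h)"
    using sum_even_splits[OF assms(2), of "\<lambda>h. B h * B' h * u h"] assms by simp
  \<comment> \<open>The mixed products of \<open>A\<close> and \<open>E\<close> cancel between the
    two signs.\<close>
  have "(A k + 1 * E k) / 2 * ((A' k + 1 * E' k) / 2) * t k
      + (A k + -1 * E k) / 2 * ((A' k + -1 * E' k) / 2) * t k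
      = (A k * A' k * t k + E k * E' k * t k) / 2" for k
    by (simp add: field_simps)
  then have K: "(\<Sum>k\<in>?K. (A k + 1 * E k) / 2 * ((A' k + 1 * E' k) / 2) * t k
        + (A k + -1 * E k) / 2 * ((A' k + -1 * E' k) / 2) * t k)
      = ((\<Sum>k\<in>?K. A k * A' k * t k) + (\<Sum>k\<in>?K. E k * E' k * t k)) / 2"
    by (simp only: sum.distrib[symmetric] sum_divide_distrib)
  show ?thesis
    unfolding sum_index_set even_row.simps T_diag.simps G H K
    by (simp add: field_simps)
qed

text \<open>For \<open>L0\<close> and \<open>Lpi\<close> the value 0 is the neutral element that
  they represent. For \<open>LGam\<close> it is a default, neutralised by \<open>gweight\<close> 0;
  likewise for \<open>hpart\<close> and \<open>hweight\<close> on \<open>LK\<close> and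
  \<open>LG\<close>.\<close>

fun gpart :: "('g::zero, 'h) label \<Rightarrow> 'g" where
  "gpart (LK k \<epsilon>) = k"
| "gpart (LG g) = g"
| "gpart _ = 0"

fun hpart :: "('g, 'h::zero) label \<Rightarrow> 'h" where
  "hpart (LGam h) = h"
| "hpart _ = 0"

text \<open>Coefficients of the even characters in a row of \<open>S\<close>. The 2 undoes the
  averaging in \<open>even_char\<close>; the -2 in \<open>hweight\<close> also carries the minus
  sign of the \<open>\<Gamma>\<close> block.\<close>

fun gweight :: "('g, 'h) label \<Rightarrow> complex" where
  "gweight (LG g) = 2"
| "gweight (LGam h) = 0"
| "gweight _ = 1"

fun hweight :: "('g, 'h) label \<Rightarrow> complex" where
  "hweight L0 = 1"
| "hweight Lpi = -1"
| "hweight (LGam h) = -2"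
| "hweight _ = 0"

fun sign_part :: "('g, 'h) label \<Rightarrow> 'g \<Rightarrow> complex" where
  "sign_part (LK k \<epsilon>) k' = (if k = k' then \<epsilon> else 0)"
| "sign_part _ k' = 0"

text \<open>The weights that build the rows of \<open>S\<close> also evaluate a row at a column. The
  minus sign at \<open>hweight\<close> will absorb the one in
  \<open>c = - gauss_sum q2\<close>.\<close>

lemma even_row_weights:
  "even_row A B E y = (gweight y * A (gpart y) - hweight y * B (hpart y) + sign_part y (gpart y) * E (gpart y)) / 2"
  by (cases y) auto

section \<open>The rows of \<open>S\<close> in coordinates, and their quadratic and orthogonality
  relations\<close>

locale s_matrix =
  fixes q1 :: "'g::{finite,ab_group_add} \<Rightarrow> complex"
    and q2 :: "'h::{finite,ab_group_add} \<Rightarrow> complex"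
    and c :: complex
    and Gs :: "'g set" and \<Gamma>s :: "'h set"
    and a b :: complex
  assumes m1: "metric_group q1" and m2: "metric_group q2"
    and odd: "odd CARD('h)"
    and c1: "c = gauss_sum q1" and c2: "c = - gauss_sum q2"
    and sG: "splits_over two_torsion Gs" and sH: "splits_over {0} \<Gamma>s"
    and a_eq: "a = inv_sqrt_order TYPE('g)" and b_eq: "b = inv_sqrt_order TYPE('h)"
begin

abbreviation "J \<equiv> index_set Gs \<Gamma>s"
abbreviation "S \<equiv> S_mat q1 q2 c"
abbreviation "t \<equiv> T_diag q1 q2"

lemma S_eq: "S = S_block a b q1 q2 c"
  by (simp add: S_mat_def a_eq b_eq)

text \<open>The three coordinates of row \<open>x\<close> of \<open>S\<close>; \<open>E x\<close> is
  supported on at most one 2-torsion element.\<close>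

definition "A x g = a * gweight x * even_char q1 (gpart x) g"
definition "B x h = b * hweight x * even_char q2 (hpart x) h"
definition "E x k = c * q1 k * sign_part x k"

lemma label_cases [consumes 1, case_names L0 Lpi LK LG LGam]:
  assumes "x \<in> J"
  obtains "x = L0" | "x = Lpi"
  | k \<epsilon> where "x = LK k \<epsilon>" "k \<in> two_torsion" "k \<noteq> 0" "\<epsilon> = 1 \<or> \<epsilon> = -1"
  | g where "x = LG g" "g \<in> Gs"
  | h where "x = LGam h" "h \<in> \<Gamma>s"
  using assms by (auto simp: index_set_def)

text \<open>A check block by block. At 2-torsion elements characters are real and agree with their
  even parts, so the \<open>LK\<close> entries need no conjugate term.\<close>

lemma S_even_row:
  assumes "x \<in> J" "y \<in> J"
  shows "S x y = even_row (A x) (B x) (E x) y"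
  using assms(1)
proof (cases rule: label_cases)
  case L0
  with assms(2) show ?thesis
    by (cases rule: label_cases) (simp_all add: S_eq A_def B_def E_def even_char_zero m1 m2)
next
  case Lpi
  with assms(2) show ?thesis
    by (cases rule: label_cases) (simp_all add: S_eq A_def B_def E_def even_char_zero m1 m2)
next
  case LK
  with assms(2) show ?thesis
    by (cases rule: label_cases)
      (simp_all add: S_eq A_def B_def E_def even_char_zero bichar_zero_left bichar_zero_right even_char_two_torsion m1 m2)
next
  case LG
  with assms(2) show ?thesis
    by (cases rule: label_cases)
      (simp_all add: S_eq A_def B_def E_def even_char_zero bichar_zero_left bichar_zero_right even_char_two_torsion m1 m2,
       simp add: even_char_def)
next
  case LGam
  with assms(2) show ?thesis
    by (cases rule: label_cases)
      (simp_all add: S_eq A_def B_def E_def even_char_zero m1 m2, simp add: even_char_def)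
qed

lemma S_symmetric: "S x y = S y x"
  by (cases x; cases y) (auto simp: S_mat_def bichar_commute)

lemma c_mult_cnj: "c * cnj c = 1"
  using gauss_sum_mult_cnj[OF m1] c1 by simp

text \<open>Oddness of the order of \<open>\<Gamma>\<close> enters through
  \<open>c = - gauss_sum q2\<close>, whose fourth power is 1.\<close>

lemma c_square: "c * c = 1 \<or> c * c = -1"
proof -
  have "(c * c) * (c * c) = 1"
    using gauss_sum_odd_fourth_power[OF m2 odd] c2 by (simp add: power4_eq_xxxx mult.assoc)
  then show ?thesis by (simp add: square_eq_1_iff)
qed

lemma q1_two_torsion_square: "k \<in> two_torsion \<Longrightarrow> q1 k * q1 k = 1 \<or> q1 k * q1 k = -1"
  using metric_group_two_torsion[OF m1, of k] by (simp add: square_eq_1_iff)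

text \<open>These facts evaluate the indicators of \<open>x = y\<close> and \<open>x + y = 0\<close>
  in the orthogonality relations: within \<open>Gs\<close> the second never holds, and between
  \<open>Gs\<close> and the 2-torsion neither does.\<close>

lemma Gs_disjoint:
  assumes "g \<in> Gs"
  shows "g \<notin> two_torsion" "g \<noteq> 0" "g' \<in> Gs \<Longrightarrow> g + g' \<noteq> 0" "g' \<in> Gs \<Longrightarrow> g' + g \<noteq> 0"
    "k \<in> two_torsion \<Longrightarrow> g + k \<noteq> 0" "k \<in> two_torsion \<Longrightarrow> k + g \<noteq> 0"
    "k \<in> two_torsion \<Longrightarrow> g \<noteq> k"
proof -
  have d: "two_torsion \<inter> Gs = {}" "two_torsion \<inter> uminus ` Gs = {}" "Gs \<inter> uminus ` Gs = {}"
    using sG by (auto simp: splits_over_def)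
  show 1: "g \<notin> two_torsion" using assms d(1) by blast
  then show "g \<noteq> 0" "k \<in> two_torsion \<Longrightarrow> g \<noteq> k" by (auto simp: two_torsion_def)
  show 2: "g + g' \<noteq> 0" if "g' \<in> Gs" for g'
    using d(3) assms that by (metis IntI add_eq_0_iff empty_iff imageI)
  show "g' + g \<noteq> 0" if "g' \<in> Gs" for g'
    using 2[OF that] by (simp add: add.commute)
  show 3: "g + k \<noteq> 0" if "k \<in> two_torsion" for k
    using d(2) assms that by (metis IntI add_eq_0_iff empty_iff imageI)
  show "k + g \<noteq> 0" if "k \<in> two_torsion" for k
    using 3[OF that] by (simp add: add.commute)
qed

lemma \<Gamma>s_disjoint:
  assumes "h \<in> \<Gamma>s"
  shows "h \<noteq> 0" "h' \<in> \<Gamma>s \<Longrightarrow> h + h' \<noteq> 0"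
proof -
  have d: "{0} \<inter> \<Gamma>s = {}" "\<Gamma>s \<inter> uminus ` \<Gamma>s = {}"
    using sH by (auto simp: splits_over_def)
  show "h \<noteq> 0" using assms d(1) by blast
  show "h + h' \<noteq> 0" if "h' \<in> \<Gamma>s"
    using d(2) assms that by (metis IntI add_eq_0_iff empty_iff imageI)
qed

lemma even_A: "A x (- g) = A x g" and even_B: "B x (- h) = B x h"
  by (simp_all add: A_def B_def even_char_minus m1 m2)

text \<open>For \<open>y\<close> of the form \<open>LK\<close> the support of
  \<open>sign_part y\<close> is the single element \<open>gpart y\<close>; for other labels both
  sides vanish.\<close>

lemma sum_sign_part:
  assumes "x \<in> J" "y \<in> J"
  shows "(\<Sum>k\<in>two_torsion - {0}. f k * sign_part x k * sign_part y k)
    = f (gpart y) * sign_part x (gpart y) * sign_part y (gpart y)"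
  using assms(2)
proof (cases rule: label_cases)
  case (LK k \<epsilon>)
  have "(\<Sum>l\<in>two_torsion - {0}. f l * sign_part x l * sign_part y l)
      = (\<Sum>l\<in>two_torsion - {0}. if l = k then f k * sign_part x k * \<epsilon> else 0)"
    by (rule sum.cong) (auto simp: LK)
  then show ?thesis using LK by simp
qed simp_all

text \<open>The entrywise form of \<open>S T S = c T\<^sup>* S T\<^sup>*\<close> for the symmetric
  matrix \<open>S\<close>. Each coordinate contributes its part of \<open>S x y\<close> with the
  same factor \<open>c * cnj (t x) * cnj (t y)\<close>.\<close>

lemma sum_S_mult_quadratic:
  assumes "x \<in> J" "y \<in> J"
  shows "(\<Sum>z\<in>J. S x z * S y z * t z) = c * cnj (t x) * cnj (t y) * S x y"
proof -
  have "(\<Sum>z\<in>J. S x z * S y z * t z)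
      = (\<Sum>z\<in>J. even_row (A x) (B x) (E x) z * even_row (A y) (B y) (E y) z * t z)"
    using assms by (simp add: S_even_row)
  also have "\<dots> = ((\<Sum>g\<in>UNIV. A x g * A y g * q1 g) + (\<Sum>h\<in>UNIV. B x h * B y h * q2 h)
      + (\<Sum>k\<in>two_torsion - {0}. E x k * E y k * q1 k)) / 2"
    by (rule sum_even_row_mult[OF sG sH])
      (simp_all add: even_A even_B metric_group_minus metric_group_zero m1 m2)
  also have "(\<Sum>g\<in>UNIV. A x g * A y g * q1 g)
      = c * cnj (t x) * cnj (t y) * (gweight y * A x (gpart y))"
  proof -
    \<comment> \<open>The two diagonal values can differ only at \<open>LGam\<close>, where the
      weight is 0.\<close>
    have T: "gweight z * cnj (q1 (gpart z)) = gweight z * cnj (t z)" for z :: "('g, 'h) label"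
      by (cases z) (simp_all add: metric_group_zero m1)
    have "(\<Sum>g\<in>UNIV. A x g * A y g * q1 g)
        = a * a * gweight x * gweight y
          * (\<Sum>g\<in>UNIV. even_char q1 (gpart x) g * even_char q1 (gpart y) g * q1 g)"
      by (simp add: A_def sum_distrib_left ac_simps)
    \<comment> \<open>One factor \<open>a\<close> and the sum of \<open>q1\<close> combine to the
      Gauss sum \<open>c\<close>; the other \<open>a\<close> stays in the row.\<close>
    also have "\<dots> = c * (gweight x * cnj (q1 (gpart x))) * (gweight y * cnj (q1 (gpart y)))
        * a * even_char q1 (gpart x) (gpart y)"
      unfolding sum_even_char_mult_quadratic[OF m1] c1 gauss_sum_def a_eq[symmetric] by (simp only: ac_simps)
    also have "\<dots> = c * cnj (t x) * cnj (t y) * (gweight y * A x (gpart y))"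
      by (simp only: T A_def ac_simps)
    finally show ?thesis .
  qed
  also have "(\<Sum>h\<in>UNIV. B x h * B y h * q2 h)
      = - c * cnj (t x) * cnj (t y) * (hweight y * B x (hpart y))"
  proof -
    have T: "hweight z * cnj (q2 (hpart z)) = hweight z * cnj (t z)" for z :: "('g, 'h) label"
      by (cases z) (simp_all add: metric_group_zero m2)
    have "(\<Sum>h\<in>UNIV. B x h * B y h * q2 h)
        = b * b * hweight x * hweight y
          * (\<Sum>h\<in>UNIV. even_char q2 (hpart x) h * even_char q2 (hpart y) h * q2 h)"
      by (simp add: B_def sum_distrib_left ac_simps)
    also have "\<dots> = - c * (hweight x * cnj (q2 (hpart x))) * (hweight y * cnj (q2 (hpart y)))
        * b * even_char q2 (hpart x) (hpart y)"
      unfolding sum_even_char_mult_quadratic[OF m2] c2 gauss_sum_def b_eq[symmetric] minus_minus by (simp only: ac_simps)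
    also have "\<dots> = - c * cnj (t x) * cnj (t y) * (hweight y * B x (hpart y))"
      by (simp only: T B_def ac_simps)
    finally show ?thesis .
  qed
  also have "(\<Sum>k\<in>two_torsion - {0}. E x k * E y k * q1 k)
      = c * cnj (t x) * cnj (t y) * (sign_part y (gpart y) * E x (gpart y))"
  proof -
    have "(\<Sum>k\<in>two_torsion - {0}. E x k * E y k * q1 k)
        = (\<Sum>k\<in>two_torsion - {0}. (c * c * q1 k * q1 k * q1 k) * sign_part x k * sign_part y k)"
      by (simp add: E_def ac_simps)
    also have "\<dots> = (c * c * q1 (gpart y) * q1 (gpart y) * q1 (gpart y))
        * sign_part x (gpart y) * sign_part y (gpart y)"
      by (rule sum_sign_part[OF assms])
    also have "\<dots> = c * cnj (t x) * cnj (t y) * (sign_part y (gpart y) * E x (gpart y))"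
    proof (cases "\<exists>k \<epsilon> \<epsilon>'. x = LK k \<epsilon> \<and> y = LK k \<epsilon>'")
      case True
      then obtain k \<epsilon> \<epsilon>' where xy: "x = LK k \<epsilon>" "y = LK k \<epsilon>'" by blast
      then have "k \<in> two_torsion" using assms by (auto simp: index_set_def)
      \<comment> \<open>\<open>(q1 k)\<^sup>2 = bichar q1 k k\<close> is real, so two of the three
        factors \<open>q1 k\<close> may be conjugated.\<close>
      then have q2: "cnj (q1 k) * cnj (q1 k) = q1 k * q1 k"
        using bichar_two_torsion_cnj[OF m1, of k k] bichar_self[OF m1, of k]
        by (simp add: power2_eq_square)
      have "c * c * q1 k * q1 k * q1 k * \<epsilon> * \<epsilon>' = c * c * q1 k * \<epsilon> * \<epsilon>' * (q1 k * q1 k)"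
        by (simp only: ac_simps)
      also have "\<dots> = c * cnj (q1 k) * cnj (q1 k) * (\<epsilon>' * (c * q1 k * \<epsilon>))"
        unfolding q2[symmetric] by (simp only: ac_simps)
      finally show ?thesis by (simp add: xy E_def)
    next
      case False
      then have "sign_part x (gpart y) * sign_part y (gpart y) = 0"
        by (cases x; cases y) auto
      then show ?thesis by (auto simp: E_def)
    qed
    finally show ?thesis .
  qed
  finally show ?thesis
    unfolding S_even_row[OF assms] even_row_weights[of _ _ _ y] by (simp add: algebra_simps)
qed

text \<open>The sign coordinate \<open>E'\<close> of the second row is left free to cover both the bilinear and, with
  \<open>E' = cnj \<circ> E y\<close>, the sesquilinear form: the other two coordinates are real.\<close>

lemma sum_even_row_orthogonal:
  assumes "x \<in> J" "y \<in> J" "\<And>k. E' k = d k * sign_part y k"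
  shows "(\<Sum>z\<in>J. S x z * even_row (A y) (B y) E' z)
    = (gweight x * gweight y * ((if gpart x = gpart y then 1 else 0) + (if gpart x + gpart y = 0 then 1 else 0))
     + hweight x * hweight y * ((if hpart x = hpart y then 1 else 0) + (if hpart x + hpart y = 0 then 1 else 0))) / 4
     + c * q1 (gpart y) * d (gpart y) * sign_part x (gpart y) * sign_part y (gpart y) / 2"
proof -
  \<comment> \<open>Constant weights 1 specialise the weighted form to the standard one.\<close>
  have T: "T_diag (\<lambda>_. 1) (\<lambda>_. 1) z = 1" for z :: "('g, 'h) label" by (cases z) auto
  have aa: "a * (a * of_nat CARD('g)) = 1" "b * (b * of_nat CARD('h)) = 1"
    unfolding a_eq b_eq mult.assoc[symmetric] by (rule inv_sqrt_order_square)+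
  have "(\<Sum>z\<in>J. S x z * even_row (A y) (B y) E' z)
      = (\<Sum>z\<in>J. even_row (A x) (B x) (E x) z * even_row (A y) (B y) E' z * T_diag (\<lambda>_. 1) (\<lambda>_. 1) z)"
    using assms by (simp add: S_even_row T)
  also have "\<dots> = ((\<Sum>g\<in>UNIV. A x g * A y g * 1) + (\<Sum>h\<in>UNIV. B x h * B y h * 1)
      + (\<Sum>k\<in>two_torsion - {0}. E x k * E' k * 1)) / 2"
    by (rule sum_even_row_mult[OF sG sH]) (simp_all add: even_A even_B)
  also have "(\<Sum>g\<in>UNIV. A x g * A y g * 1)
      = a * (a * of_nat CARD('g)) * gweight x * gweight y
        * ((if gpart x = gpart y then 1 else 0) + (if gpart x + gpart y = 0 then 1 else 0)) / 2"
  proof -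
    have "(\<Sum>g\<in>UNIV. A x g * A y g * 1)
        = a * a * gweight x * gweight y * (\<Sum>g\<in>UNIV. even_char q1 (gpart x) g * even_char q1 (gpart y) g)"
      by (simp add: A_def sum_distrib_left ac_simps)
    then show ?thesis unfolding sum_even_char_mult[OF m1] by (simp add: ac_simps)
  qed
  also have "(\<Sum>h\<in>UNIV. B x h * B y h * 1)
      = b * (b * of_nat CARD('h)) * hweight x * hweight y
        * ((if hpart x = hpart y then 1 else 0) + (if hpart x + hpart y = 0 then 1 else 0)) / 2"
  proof -
    have "(\<Sum>h\<in>UNIV. B x h * B y h * 1)
        = b * b * hweight x * hweight y * (\<Sum>h\<in>UNIV. even_char q2 (hpart x) h * even_char q2 (hpart y) h)"
      by (simp add: B_def sum_distrib_left ac_simps)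
    then show ?thesis unfolding sum_even_char_mult[OF m2] by (simp add: ac_simps)
  qed
  also have "(\<Sum>k\<in>two_torsion - {0}. E x k * E' k * 1)
      = (\<Sum>k\<in>two_torsion - {0}. (c * q1 k * d k) * sign_part x k * sign_part y k)"
    by (simp add: E_def assms(3) ac_simps)
  also have "\<dots> = (c * q1 (gpart y) * d (gpart y)) * sign_part x (gpart y) * sign_part y (gpart y)"
    by (rule sum_sign_part[OF assms(1,2)])
  finally show ?thesis unfolding aa by (simp add: add_divide_distrib)
qed

text \<open>On two labels over the same \<open>k\<close> the \<open>G\<close> part gives 1/2 and the
  sign part gives \<open>s * \<epsilon> * \<eta> / 2\<close> with
  \<open>s = c\<^sup>2 * bichar q1 k k\<close>. Their sum is the indicator of
  \<open>\<epsilon> = s * \<eta>\<close>, which is how the involution arises.\<close>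

lemma sum_S_mult:
  assumes "x \<in> J" "y \<in> J"
  shows "(\<Sum>z\<in>J. S x z * S y z) = C_mat q1 c x y"
proof -
  have "(\<Sum>z\<in>J. S x z * S y z) = (\<Sum>z\<in>J. S x z * even_row (A y) (B y) (E y) z)"
    using assms by (simp add: S_even_row)
  also note sum_even_row_orthogonal[OF assms, of "E y" "\<lambda>k. c * q1 k"]
  finally have eq: "(\<Sum>z\<in>J. S x z * S y z)
    = (gweight x * gweight y * ((if gpart x = gpart y then 1 else 0) + (if gpart x + gpart y = 0 then 1 else 0))
     + hweight x * hweight y * ((if hpart x = hpart y then 1 else 0) + (if hpart x + hpart y = 0 then 1 else 0))) / 4
     + c * q1 (gpart y) * (c * q1 (gpart y)) * sign_part x (gpart y) * sign_part y (gpart y) / 2"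
    by (simp add: E_def)
  from assms(1) show ?thesis
  proof (cases rule: label_cases)
    case L0
    with assms(2) show ?thesis unfolding eq
      by (cases rule: label_cases) (auto simp: C_mat_def Gs_disjoint \<Gamma>s_disjoint dest: Gs_disjoint \<Gamma>s_disjoint)
  next
    case Lpi
    with assms(2) show ?thesis unfolding eq
      by (cases rule: label_cases) (auto simp: C_mat_def Gs_disjoint \<Gamma>s_disjoint dest: Gs_disjoint \<Gamma>s_disjoint)
  next
    case LG
    with assms(2) show ?thesis unfolding eq
      by (cases rule: label_cases) (auto simp: C_mat_def Gs_disjoint \<Gamma>s_disjoint dest: Gs_disjoint \<Gamma>s_disjoint)
  next
    case LGam
    with assms(2) show ?thesis unfolding eq
      by (cases rule: label_cases) (auto simp: C_mat_def Gs_disjoint \<Gamma>s_disjoint dest: Gs_disjoint \<Gamma>s_disjoint)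
  next
    case x: (LK k \<epsilon>)
    from assms(2) show ?thesis
    proof (cases rule: label_cases)
      case y: (LK l \<eta>)
      \<comment> \<open>On 2-torsion both indicators of the orthogonality relation coincide.\<close>
      have kl: "k + l = 0 \<longleftrightarrow> k = l"
        using x y by (auto simp: two_torsion_def add_eq_0_iff)
      define s where "s = (c * c) * (q1 l * q1 l)"
      have s: "s = 1 \<or> s = -1"
        using c_square q1_two_torsion_square[OF y(2)] unfolding s_def by (elim disjE) simp_all
      have cq: "c * q1 l * (c * q1 l) = s"
        by (simp only: s_def ac_simps)
      have "C_mat q1 c x y = (if k = l \<and> \<epsilon> = s * \<eta> then 1 else 0)"
        by (simp add: C_mat_def x(1) y(1) s_def bichar_self[OF m1] power2_eq_square)
      then show ?thesis
        unfolding eq unfolding x(1) y(1) gpart.simps hpart.simps cq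
        using x(4) y(4) s by (elim disjE) (simp_all add: kl)
    qed (unfold eq, use x in \<open>auto simp: C_mat_def Gs_disjoint\<close>)
  qed
qed

text \<open>Conjugation affects only the \<open>E\<close> coordinate: the sign \<open>s\<close> of
  the bilinear case becomes the product of \<open>c * cnj c\<close> and
  \<open>q1 k * cnj (q1 k)\<close>, which is 1, so the identity replaces \<open>C\<close>.\<close>

lemma sum_S_mult_cnj:
  assumes "x \<in> J" "y \<in> J"
  shows "(\<Sum>z\<in>J. S x z * cnj (S y z)) = mat_one x y"
proof -
  have sg: "cnj (sign_part y k) = sign_part y k" for k
    using assms(2) by (cases rule: label_cases) auto
  have "cnj (S y z) = even_row (A y) (B y) (\<lambda>k. cnj (E y k)) z" if "z \<in> J" for z
  proof -
    have "cnj (gweight y) = gweight y" "cnj (hweight y) = hweight y" by (cases y; simp)+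
    moreover have "cnj a = a" "cnj b = b"
      by (simp_all add: a_eq b_eq cnj_inv_sqrt_order)
    ultimately have AB: "cnj (A y g) = A y g" "cnj (B y h) = B y h" for g h
      by (simp_all add: A_def B_def cnj_even_char)
    from that show ?thesis
      unfolding S_even_row[OF assms(2) that] by (cases rule: label_cases) (auto simp: AB)
  qed
  then have "(\<Sum>z\<in>J. S x z * cnj (S y z)) = (\<Sum>z\<in>J. S x z * even_row (A y) (B y) (\<lambda>k. cnj (E y k)) z)"
    by simp
  also note sum_even_row_orthogonal[OF assms, of "\<lambda>k. cnj (E y k)" "\<lambda>k. cnj c * cnj (q1 k)"]
  finally have "(\<Sum>z\<in>J. S x z * cnj (S y z))
    = (gweight x * gweight y * ((if gpart x = gpart y then 1 else 0) + (if gpart x + gpart y = 0 then 1 else 0))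
     + hweight x * hweight y * ((if hpart x = hpart y then 1 else 0) + (if hpart x + hpart y = 0 then 1 else 0))) / 4
     + c * q1 (gpart y) * (cnj c * cnj (q1 (gpart y))) * sign_part x (gpart y) * sign_part y (gpart y) / 2"
    by (simp add: E_def sg)
  also have "c * q1 (gpart y) * (cnj c * cnj (q1 (gpart y))) = (c * cnj c) * (q1 (gpart y) * cnj (q1 (gpart y)))"
    by (simp only: ac_simps)
  also have "\<dots> = 1" by (simp add: c_mult_cnj metric_group_mult_cnj[OF m1])
  finally have eq: "(\<Sum>z\<in>J. S x z * cnj (S y z))
    = (gweight x * gweight y * ((if gpart x = gpart y then 1 else 0) + (if gpart x + gpart y = 0 then 1 else 0))
     + hweight x * hweight y * ((if hpart x = hpart y then 1 else 0) + (if hpart x + hpart y = 0 then 1 else 0))) / 4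
     + sign_part x (gpart y) * sign_part y (gpart y) / 2" by simp
  from assms(1) show ?thesis
  proof (cases rule: label_cases)
    case L0
    with assms(2) show ?thesis unfolding eq
      by (cases rule: label_cases) (auto simp: mat_one_def Gs_disjoint \<Gamma>s_disjoint dest: Gs_disjoint \<Gamma>s_disjoint)
  next
    case Lpi
    with assms(2) show ?thesis unfolding eq
      by (cases rule: label_cases) (auto simp: mat_one_def Gs_disjoint \<Gamma>s_disjoint dest: Gs_disjoint \<Gamma>s_disjoint)
  next
    case LG
    with assms(2) show ?thesis unfolding eq
      by (cases rule: label_cases) (auto simp: mat_one_def Gs_disjoint \<Gamma>s_disjoint dest: Gs_disjoint \<Gamma>s_disjoint)
  next
    case LGam
    with assms(2) show ?thesis unfolding eq
      by (cases rule: label_cases) (auto simp: mat_one_def Gs_disjoint \<Gamma>s_disjoint dest: Gs_disjoint \<Gamma>s_disjoint)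
  next
    case x: (LK k \<epsilon>)
    from assms(2) show ?thesis
    proof (cases rule: label_cases)
      case y: (LK l \<eta>)
      have kl: "k + l = 0 \<longleftrightarrow> k = l"
        using x y by (auto simp: two_torsion_def add_eq_0_iff)
      show ?thesis
        unfolding eq unfolding x(1) y(1) gpart.simps hpart.simps
        using x(4) y(4) by (auto simp: kl mat_one_def)
    qed (unfold eq, use x in \<open>auto simp: mat_one_def Gs_disjoint\<close>)
  qed
qed

section \<open>The matrix identities\<close>

text \<open>Both \<open>c\<^sup>2\<close> and \<open>bichar q1 k k = (q1 k)\<^sup>2\<close> are
  signs, so the new second component is again 1 or -1.\<close>

lemma label_bar_in_J:
  assumes "x \<in> J"
  shows "label_bar q1 c x \<in> J"
  using assms
proof (cases rule: label_cases)
  case (LK k \<epsilon>)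
  then show ?thesis
    using c_square q1_two_torsion_square[OF LK(2)]
    by (auto simp: index_set_def bichar_self[OF m1] power2_eq_square)
qed (auto simp: index_set_def)

lemma label_bar_involution:
  assumes "x \<in> J"
  shows "label_bar q1 c (label_bar q1 c x) = x"
  using assms
proof (cases rule: label_cases)
  case (LK k \<epsilon>)
  then show ?thesis
    using c_square q1_two_torsion_square[OF LK(2)]
    by (auto simp: bichar_self[OF m1] power2_eq_square)
qed auto

lemma t_label_bar: "t (label_bar q1 c x) = t x"
  by (cases x) auto

lemma t_mult_cnj: "t x * cnj (t x) = 1" "cnj (t x) * t x = 1"
  by (cases x; simp add: metric_group_mult_cnj m1 m2)+

lemma C_symmetric:
  assumes "x \<in> J" "y \<in> J"
  shows "C_mat q1 c x y = C_mat q1 c y x"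
  using label_bar_involution[OF assms(1)] label_bar_involution[OF assms(2)]
  by (auto simp: C_mat_def)

lemma sum_C_mult:
  assumes "y \<in> J"
  shows "(\<Sum>z\<in>J. f z * C_mat q1 c z y) = f (label_bar q1 c y)"
  using label_bar_in_J[OF assms] by (simp add: C_mat_def if_distrib[of "\<lambda>u. _ * u"] cong: if_cong)

lemma unitary_S: "mat_unitary J S"
proof -
  have "(\<Sum>z\<in>J. cnj (S z x) * S z y) = mat_one x y" if "x \<in> J" "y \<in> J" for x y
  proof -
    \<comment> \<open>Symmetry of \<open>S\<close> turns orthogonality of columns into that of rows
      with \<open>x\<close> and \<open>y\<close> exchanged.\<close>
    have "cnj (S z x) * S z y = S y z * cnj (S x z)" for z
      unfolding S_symmetric[of z x] S_symmetric[of z y] by (rule mult.commute)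
    then show ?thesis
      using sum_S_mult_cnj[OF that(2,1)] by (simp add: mat_one_def)
  qed
  then show ?thesis
    by (simp add: mat_unitary_def mat_eq_def mat_mult_def Defs.mat_adjoint_def sum_S_mult_cnj)
qed

lemma unitary_T: "mat_unitary J (T_mat q1 q2)"
  by (auto simp: mat_unitary_def mat_eq_def mat_mult_def Defs.mat_adjoint_def mat_one_def T_mat_def
      if_distrib[of cnj] if_distrib[of "\<lambda>u. u * _"] t_mult_cnj cong: if_cong)

text \<open>\<open>C\<close> is real, and symmetric with square 1 because it is the permutation
  matrix of an involution.\<close>

lemma unitary_C: "mat_unitary J (C_mat q1 c)"
proof -
  have cnj_C: "cnj (C_mat q1 c x y) = C_mat q1 c x y" for x y :: "('g, 'h) label"
    by (simp add: C_mat_def)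
  have CC: "(\<Sum>z\<in>J. C_mat q1 c x z * C_mat q1 c z y) = mat_one x y" if "x \<in> J" "y \<in> J" for x y
    using that by (simp add: sum_C_mult) (simp add: C_mat_def mat_one_def label_bar_involution)
  have "(\<Sum>z\<in>J. C_mat q1 c x z * C_mat q1 c y z) = mat_one x y"
    "(\<Sum>z\<in>J. C_mat q1 c z x * C_mat q1 c z y) = mat_one x y" if "x \<in> J" "y \<in> J" for x y
    using CC[OF that] that by (simp_all add: C_symmetric[of y] C_symmetric[of x] cong: sum.cong)
  then show ?thesis
    by (simp add: mat_unitary_def mat_eq_def mat_mult_def Defs.mat_adjoint_def cnj_C)
qed

lemma S_square: "mat_eq J (mat_pow J S 2) (C_mat q1 c)"
proof -
  have "mat_pow J S 2 x y = C_mat q1 c x y" if "x \<in> J" "y \<in> J" for x y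
  proof -
    have "mat_pow J S 2 x y = (\<Sum>z\<in>J. S x z * S z y)"
      using that by (simp add: eval_nat_numeral mat_mult_def mat_one_def if_distrib cong: if_cong)
    then show ?thesis using sum_S_mult[OF that] by (simp add: S_symmetric[of _ y])
  qed
  then show ?thesis by (simp add: mat_eq_def)
qed

lemma ST_entry:
  assumes "y \<in> J"
  shows "mat_mult J S (T_mat q1 q2) x y = S x y * t y"
  using assms by (simp add: mat_mult_def T_mat_def if_distrib[of "\<lambda>u. _ * u"] cong: if_cong)

text \<open>In \<open>S T (S T S) T\<close> the two adjoints coming from \<open>S T S\<close> cancel
  the two remaining factors \<open>T\<close>, which leaves \<open>c S\<^sup>2\<close>.\<close>

lemma ST_cube: "mat_eq J (mat_pow J (mat_mult J S (T_mat q1 q2)) 3) (mat_scale c (C_mat q1 c))"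
proof -
  let ?M = "mat_mult J S (T_mat q1 q2)"
  have "mat_pow J ?M 3 x y = c * C_mat q1 c x y" if xy: "x \<in> J" "y \<in> J" for x y
  proof -
    have "mat_pow J ?M 3 x y = (\<Sum>z\<in>J. ?M x z * (\<Sum>w\<in>J. ?M z w * (\<Sum>v\<in>J. ?M w v * mat_one v y)))"
      by (simp add: eval_nat_numeral mat_mult_def)
    also have "\<dots> = (\<Sum>z\<in>J. S x z * t z * (\<Sum>w\<in>J. S z w * t w * (S w y * t y)))"
      using xy by (simp add: ST_entry mat_one_def if_distrib[of "\<lambda>u. _ * u"] cong: if_cong sum.cong)
    also have "\<dots> = (\<Sum>z\<in>J. S x z * t z * (t y * (\<Sum>w\<in>J. S z w * S y w * t w)))"
      by (simp add: S_symmetric[of _ y] sum_distrib_left ac_simps)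
    also have "\<dots> = (\<Sum>z\<in>J. c * (S x z * S y z))"
    proof (rule sum.cong[OF refl])
      fix z assume z: "z \<in> J"
      have "S x z * t z * (t y * (\<Sum>w\<in>J. S z w * S y w * t w))
          = (t z * cnj (t z)) * (t y * cnj (t y)) * (c * (S x z * S y z))"
        unfolding sum_S_mult_quadratic[OF z xy(2)] S_symmetric[of z y] by (simp only: ac_simps)
      then show "S x z * t z * (t y * (\<Sum>w\<in>J. S z w * S y w * t w)) = c * (S x z * S y z)"
        by (simp add: t_mult_cnj)
    qed
    also have "\<dots> = c * C_mat q1 c x y"
      by (simp add: sum_distrib_left[symmetric] sum_S_mult[OF xy])
    finally show ?thesis .
  qed
  then show ?thesis by (simp add: mat_eq_def mat_scale_def)
qed

text \<open>The involution changes only the sign in \<open>LK k \<epsilon>\<close>, and the diagonal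
  of \<open>T\<close> does not depend on it.\<close>

lemma TC_commute: "mat_eq J (mat_mult J (T_mat q1 q2) (C_mat q1 c)) (mat_mult J (C_mat q1 c) (T_mat q1 q2))"
  unfolding mat_eq_def
proof (intro ballI)
  fix x y assume xy: "x \<in> J" "y \<in> J"
  have "mat_mult J (T_mat q1 q2) (C_mat q1 c) x y = T_mat q1 q2 x (label_bar q1 c y)"
    unfolding mat_mult_def by (rule sum_C_mult[OF xy(2)])
  also have "\<dots> = C_mat q1 c x y * t y"
    by (simp add: T_mat_def C_mat_def t_label_bar)
  also have "\<dots> = mat_mult J (C_mat q1 c) (T_mat q1 q2) x y"
    using xy by (simp add: mat_mult_def T_mat_def if_distrib[of "\<lambda>u. _ * u"] cong: if_cong)
  finally show "mat_mult J (T_mat q1 q2) (C_mat q1 c) x y = mat_mult J (C_mat q1 c) (T_mat q1 q2) x y" .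
qed

end

theorem lemma6p2:
  fixes q1 :: "'g::{finite,ab_group_add} \<Rightarrow> complex"
    and q2 :: "'h::{finite,ab_group_add} \<Rightarrow> complex"
    and c :: complex
    and Gs :: "'g set" and \<Gamma>s :: "'h set"
  assumes "metric_group q1" and "metric_group q2"
    and "even CARD('g)" and "odd CARD('h)"
    and "c = gauss_sum q1" and "c = - gauss_sum q2"
    and "splits_over two_torsion Gs" and "splits_over {0} \<Gamma>s"
  shows "let J = index_set Gs \<Gamma>s; S = S_mat q1 q2 c; T = T_mat q1 q2; C = C_mat q1 c in
    mat_unitary J S \<and> mat_unitary J T \<and> mat_unitary J C \<and>
    mat_eq J (mat_pow J S 2) C \<and>
    mat_eq J (mat_pow J (mat_mult J S T) 3) (mat_scale c C) \<and>
    mat_eq J (mat_mult J T C) (mat_mult J C T)"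
proof -
  interpret s_matrix q1 q2 c Gs \<Gamma>s "inv_sqrt_order TYPE('g)" "inv_sqrt_order TYPE('h)"
    by (rule s_matrix.intro) (rule assms refl)+
  show ?thesis
    unfolding Let_def using unitary_S unitary_T unitary_C S_square ST_cube TC_commute by blast
qed

end
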